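(* Let $f:[0,\infty)\to[0,\infty)$ be a bijection. Then the entrywise map $A\mapsto f[A]$ is a Loewner order automorphism of $\mathcal C_{\min,n}$ for every $n\ge1$ (equivalently, of $\mathcal C_{\max,n}$ for every $n\ge1$) if and only if there is a constant $c>0$ such that $f(t)=ct$ for all $t\ge0$.
   Context: For $x=(x_1,\ldots,x_n)\in\mathbb R^n$, define the $n\times n$ real symmetric matrices $A_{\min}(x)=\bigl(x_{\min(i,j)}\bigr)_{i,j=1}^n$ and $A_{\max}(x)=\bigl(x_{\max(i,j)}\bigr)_{i,j=1}^n$. Set $\mathcal C_{\min,n}=\{A_{\min}(x):0\le x_1\le x_2\le\cdots\le x_n\}$ and $\mathcal C_{\max,n}=\{A_{\max}(x):x_1\ge x_2\ge\cdots\ge x_n\ge0\}$. For a matrix $A=(a_{ij})$ with entries in $[0,\infty)$, $f[A]=(f(a_{ij}))$. For real symmetric matrices, $A\preceq B$ means that $B-A$ is positive semidefinite (Loewner order). A Loewner order automorphism of a cone $\mathcal C$ is a bijection $\Phi:\mathcal C\to\mathcal C$ such that both $\Phi$ and $\Phi^{-1}$ preserve the Loewner order, i.e. $A\preceq B$ if and only if $\Phi(A)\preceq\Phi(B)$ for all $A,B\in\mathcal C$. *)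

theory Defs
  imports Complex_Main "Jordan_Normal_Form.Matrix"
begin

text \<open>
  The size \<open>n\<close> is quantified inside the statement, so matrices are carrier-based.
  Indices run over \<open>0, \<dots>, n - 1\<close>; shifting \<open>1, \<dots>, n\<close> down by one commutes with
  \<open>min\<close> and \<open>max\<close>.
\<close>

definition A_min :: "real vec \<Rightarrow> real mat" where
  "A_min x = mat (dim_vec x) (dim_vec x) (\<lambda>(i, j). x $ min i j)"

definition A_max :: "real vec \<Rightarrow> real mat" where
  "A_max x = mat (dim_vec x) (dim_vec x) (\<lambda>(i, j). x $ max i j)"

definition C_min :: "nat \<Rightarrow> real mat set" where
  "C_min n = {A_min x |x. x \<in> carrier_vec n \<and> (\<forall>i<n. 0 \<le> x $ i) \<and> mono_on {..<n} (\<lambda>i. x $ i)}"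

definition C_max :: "nat \<Rightarrow> real mat set" where
  "C_max n = {A_max x |x. x \<in> carrier_vec n \<and> (\<forall>i<n. 0 \<le> x $ i) \<and> antimono_on {..<n} (\<lambda>i. x $ i)}"

text \<open>The equation below also forces \<open>A\<close> to be square.\<close>

definition symmetric_mat :: "real mat \<Rightarrow> bool" where
  "symmetric_mat A \<longleftrightarrow> transpose_mat A = A"

definition pos_semidef :: "real mat \<Rightarrow> bool" where
  "pos_semidef A \<longleftrightarrow> symmetric_mat A \<and> (\<forall>v \<in> carrier_vec (dim_row A). 0 \<le> v \<bullet> (A *\<^sub>v v))"

text \<open>
  The dimensions are compared explicitly because \<open>B - A\<close> takes its dimensions from \<open>A\<close> alone.
\<close>

definition loewner_le :: "real mat \<Rightarrow> real mat \<Rightarrow> bool" (infix \<open>\<preceq>\<^sub>L\<close> 50) where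
  "A \<preceq>\<^sub>L B \<longleftrightarrow> symmetric_mat A \<and> symmetric_mat B \<and> dim_row A = dim_row B \<and> pos_semidef (B - A)"

definition loewner_automorphism :: "real mat set \<Rightarrow> (real mat \<Rightarrow> real mat) \<Rightarrow> bool" where
  "loewner_automorphism C \<Phi> \<longleftrightarrow>
     bij_betw \<Phi> C C \<and> (\<forall>A\<in>C. \<forall>B\<in>C. A \<preceq>\<^sub>L B \<longleftrightarrow> \<Phi> A \<preceq>\<^sub>L \<Phi> B)"

end

theory Submission
  imports Defs
begin

text \<open>
  Everything is decided by matrices of size two. Both \<open>A_min (a, b)\<close> and \<open>A_max (b, a)\<close> have,
  up to the order of the two variables, the quadratic form
  \<open>a * (u + v)\<^sup>2 + (b - a) * v\<^sup>2\<close>, so the Loewner order compares both \<open>a\<close> and the increment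
  \<open>b - a\<close> (\<open>loewner_le_A_min_two\<close>, \<open>loewner_le_A_max_two\<close>). For an automorphism, comparing
  constant pairs makes \<open>f\<close> monotone, and comparing \<open>(0, h)\<close> with \<open>(s, s + h)\<close>, whose
  increments agree, makes \<open>f\<close> superadditive. Comparing \<open>(0, h)\<close> with the pair \<open>(s, d)\<close> for which the increments agree after applying \<open>f\<close>
  makes \<open>f\<close> subadditive (\<open>additive_of_increment_comparison\<close>). A monotone additive function on
  the half-line is linear (\<open>monotone_additive_imp_linear\<close>).

  Conversely, \<open>f t = c * t\<close> acts on both cones as the scalar \<open>c\<close>, and a positive scalar is a
  Loewner order automorphism of every set of matrices that is closed under positive scaling
  (\<open>loewner_automorphism_scaling\<close>).
\<close>

section \<open>Functions that preserve comparison of increments\<close>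

lemma additive_scale_nat:
  fixes f :: "real \<Rightarrow> real"
  assumes zero: "f 0 = 0"
    and add: "\<And>s t. 0 \<le> s \<Longrightarrow> 0 \<le> t \<Longrightarrow> f (s + t) = f s + f t"
    and "0 \<le> t"
  shows "f (real n * t) = real n * f t"
proof (induction n)
  case 0
  then show ?case using zero by simp
next
  case (Suc n)
  have "f (real (Suc n) * t) = f (real n * t + t)" by (simp add: algebra_simps)
  also have "\<dots> = real n * f t + f t" using add[of "real n * t" t] \<open>0 \<le> t\<close> Suc by simp
  finally show ?case by (simp add: algebra_simps)
qed

text \<open>
  Additivity gives linearity at the integers. Trapping \<open>n * t\<close> between consecutive integers then
  bounds \<open>n * \<bar>f t - f 1 * t\<bar>\<close> independently of \<open>n\<close>.
\<close>

lemma monotone_additive_imp_linear: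
  fixes f :: "real \<Rightarrow> real"
  assumes zero: "f 0 = 0"
    and add: "\<And>s t. 0 \<le> s \<Longrightarrow> 0 \<le> t \<Longrightarrow> f (s + t) = f s + f t"
    and mono: "\<And>s t. 0 \<le> s \<Longrightarrow> s \<le> t \<Longrightarrow> f s \<le> f t"
    and "0 \<le> t"
  shows "f t = f 1 * t"
proof -
  have nat_mult: "f (real n * u) = real n * f u" if "0 \<le> u" for n u
    using additive_scale_nat[of f, OF zero add that] by blast
  have nonneg: "0 \<le> f 1" using mono[of 0 1] zero by simp
  have bound: "real n * \<bar>f t - f 1 * t\<bar> \<le> f 1" for n
  proof -
    define k where "k = nat \<lfloor>real n * t\<rfloor>"
    have k: "real k \<le> real n * t" "real n * t \<le> real (Suc k)"
      using \<open>0 \<le> t\<close> unfolding k_def by (auto, linarith)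
    have "real k * f 1 \<le> real n * f t"
      using mono[OF _ k(1)] nat_mult[of 1 k] nat_mult[of t n] \<open>0 \<le> t\<close> by simp
    moreover have "real n * f t \<le> real (Suc k) * f 1"
      using mono[OF _ k(2)] nat_mult[of 1 "Suc k"] nat_mult[of t n] \<open>0 \<le> t\<close> by simp
    moreover have "real k * f 1 \<le> real n * t * f 1" "real n * t * f 1 \<le> real (Suc k) * f 1"
      using k nonneg by (auto intro: mult_right_mono)
    ultimately have "\<bar>real n * f t - real n * t * f 1\<bar> \<le> f 1"
      by (simp add: algebra_simps)
    moreover have "real n * f t - real n * t * f 1 = real n * (f t - f 1 * t)"
      by (simp add: algebra_simps)
    ultimately show ?thesis by (simp add: abs_mult)
  qed
  have "\<bar>f t - f 1 * t\<bar> = 0"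
  proof (rule ccontr)
    assume "\<bar>f t - f 1 * t\<bar> \<noteq> 0"
    then have "0 < \<bar>f t - f 1 * t\<bar>" by simp
    then obtain n where "f 1 < real n * \<bar>f t - f 1 * t\<bar>"
      using reals_Archimedean3 by blast
    with bound[of n] show False by simp
  qed
  then show ?thesis by simp
qed

text \<open>
  Read \<open>(a, b)\<close> and \<open>(c, d)\<close> as the generating vectors of two matrices of size two: the
  condition is invariance of the Loewner order under \<open>f\<close>, in a form shared by both cones.
\<close>

locale increment_comparison =
  fixes f :: "real \<Rightarrow> real"
  assumes bij: "bij_betw f {0..} {0..}"
    and compare: "\<And>a b c d. \<lbrakk>0 \<le> a; a \<le> b; 0 \<le> c; c \<le> d\<rbrakk> \<Longrightarrow>
      a \<le> c \<and> b - a \<le> d - c \<longleftrightarrow> f a \<le> f c \<and> f b - f a \<le> f d - f c"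
begin

lemma nonneg: "0 \<le> t \<Longrightarrow> 0 \<le> f t"
  using bij bij_betwE by fastforce

lemma mono: "0 \<le> s \<Longrightarrow> s \<le> t \<Longrightarrow> f s \<le> f t"
  using compare[of s s t t] by simp

lemma zero: "f 0 = 0"
proof -
  obtain z where "0 \<le> z" "f z = 0"
    using bij by (metis atLeast_iff bij_betw_def imageE order_refl)
  then show ?thesis using mono[of 0 z] nonneg[of 0] by simp
qed

text \<open>
  The forward implication compares equal increments, the backward one equal increments of the
  values; together they say that \<open>f\<close> and its inverse are both superadditive.
\<close>

lemma additive_of_increment_comparison:
  assumes "0 \<le> s" "0 \<le> t"
  shows "f (s + t) = f s + f t"
proof (rule antisym)
  obtain d where d: "0 \<le> d" "f d = f s + f t"
    using bij nonneg[OF assms(1)] nonneg[OF assms(2)]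
    by (metis add_nonneg_nonneg atLeast_iff bij_betw_def imageE)
  have "s \<le> d"
  proof (rule ccontr)
    assume "\<not> s \<le> d"
    \<comment> \<open>Monotonicity would then force \<open>f d = f s\<close>, against injectivity.\<close>
    then have "f d = f s" using mono[of d s] d nonneg[OF assms(2)] by simp
    then have "d = s" using bij d assms(1) by (auto simp: bij_betw_def inj_on_def)
    with \<open>\<not> s \<le> d\<close> show False by simp
  qed
  then have "s + t \<le> d"
    using compare[of 0 t s d] assms d zero nonneg[OF assms(1)] by simp
  then show "f (s + t) \<le> f s + f t" using mono[of "s + t" d] assms d by simp
next
  show "f s + f t \<le> f (s + t)"
    using compare[of 0 t s "s + t"] assms zero by simp
qed

lemma linear: "\<exists>c>0. \<forall>t\<ge>0. f t = c * t"
proof (intro exI conjI allI impI)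
  show "f t = f 1 * t" if "0 \<le> t" for t
    using monotone_additive_imp_linear[of f, OF zero additive_of_increment_comparison mono that] .
  have "f 1 \<noteq> f 0" using bij inj_onD[of f "{0..}" 1 0] by (auto simp: bij_betw_def)
  then show "0 < f 1" using nonneg[of 1] zero by simp
qed

end

section \<open>The Loewner order on the cones\<close>

lemma vec_two:
  "vec_of_list [a, b] \<in> carrier_vec 2"
  "vec_of_list [a, b] $ 0 = a" "vec_of_list [a, b] $ Suc 0 = b"
  "dim_vec (vec_of_list [a, b]) = 2"
  by (rule carrier_vecI) (simp_all add: vec_of_list_index)

lemma symmetric_A_min: "symmetric_mat (A_min x)"
  unfolding symmetric_mat_def A_min_def by (rule eq_matI) (auto simp: min.commute)

lemma symmetric_A_max: "symmetric_mat (A_max x)"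
  unfolding symmetric_mat_def A_max_def by (rule eq_matI) (auto simp: max.commute)

lemma quadratic_form_two:
  assumes "A \<in> carrier_mat 2 2" "v \<in> carrier_vec 2"
  shows "v \<bullet> (A *\<^sub>v v) =
    (v $ 0) * (A $$ (0, 0) * v $ 0 + A $$ (0, 1) * v $ 1) +
    (v $ 1) * (A $$ (1, 0) * v $ 0 + A $$ (1, 1) * v $ (1 :: nat) :: real)"
  using assms by (auto simp: scalar_prod_def numeral_2_eq_2)

text \<open>
  A symmetric matrix with entries \<open>p, p, p, q\<close> has the form \<open>p * (u + v)\<^sup>2 + (q - p) * v\<^sup>2\<close>; the
  index \<open>i\<close> carries the diagonal entry \<open>p\<close>, so that both cones are covered.
\<close>

lemma pos_semidef_two:
  fixes i j :: nat
  assumes A: "A \<in> carrier_mat 2 2" and ij: "{i, j} = {0, 1}"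
    and entries: "A $$ (i, i) = p" "A $$ (i, j) = p" "A $$ (j, i) = p" "A $$ (j, j) = q"
  shows "pos_semidef A \<longleftrightarrow> 0 \<le> p \<and> p \<le> q"
proof -
  have cases: "i = 0 \<and> j = 1 \<or> i = 1 \<and> j = 0" using ij by (auto simp: doubleton_eq_iff)
  have form: "v \<bullet> (A *\<^sub>v v) = p * (v $ i + v $ j)\<^sup>2 + (q - p) * (v $ j)\<^sup>2"
    if "v \<in> carrier_vec 2" for v
    using cases quadratic_form_two[OF A that] entries
    by (auto simp: power2_eq_square algebra_simps)
  have sym: "symmetric_mat A"
    unfolding symmetric_mat_def using A cases entries
    by (intro eq_matI) (auto simp: less_2_cases_iff)
  show ?thesis
  proof
    assume psd: "pos_semidef A"
    have test: "0 \<le> v \<bullet> (A *\<^sub>v v)" if "v \<in> carrier_vec 2" for v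
      using psd that A unfolding pos_semidef_def by auto
    \<comment> \<open>Each of the two test vectors annihilates one of the squares.\<close>
    define u where "u = vec 2 (\<lambda>k. if k = i then 1 else 0 :: real)"
    define w where "w = vec 2 (\<lambda>k. if k = i then -1 else 1 :: real)"
    have "u \<in> carrier_vec 2" "w \<in> carrier_vec 2" unfolding u_def w_def by auto
    moreover have "u $ i = 1" "u $ j = 0" "w $ i = -1" "w $ j = 1"
      using cases unfolding u_def w_def by auto
    ultimately show "0 \<le> p \<and> p \<le> q" using test[of u] test[of w] form[of u] form[of w] by simp
  next
    assume "0 \<le> p \<and> p \<le> q"
    then show "pos_semidef A"
      unfolding pos_semidef_def using sym form A by simp
  qed
qed

lemma loewner_le_A_min_two:
  "A_min (vec_of_list [a, b]) \<preceq>\<^sub>L A_min (vec_of_list [c, d]) \<longleftrightarrow> a \<le> c \<and> b - a \<le> d - c"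
proof -
  let ?D = "A_min (vec_of_list [c, d]) - A_min (vec_of_list [a, b])"
  have "pos_semidef ?D \<longleftrightarrow> 0 \<le> c - a \<and> c - a \<le> d - b"
    by (rule pos_semidef_two[of _ 0 1]) (auto simp: A_min_def vec_two)
  then show ?thesis
    unfolding loewner_le_def by (auto simp: symmetric_A_min, auto simp: A_min_def)
qed

lemma loewner_le_A_max_two:
  "A_max (vec_of_list [b, a]) \<preceq>\<^sub>L A_max (vec_of_list [d, c]) \<longleftrightarrow> a \<le> c \<and> b - a \<le> d - c"
proof -
  let ?D = "A_max (vec_of_list [d, c]) - A_max (vec_of_list [b, a])"
  have "pos_semidef ?D \<longleftrightarrow> 0 \<le> c - a \<and> c - a \<le> d - b"
    by (rule pos_semidef_two[of _ 1 0]) (auto simp: A_max_def vec_two)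
  then show ?thesis
    unfolding loewner_le_def by (auto simp: symmetric_A_max, auto simp: A_max_def)
qed

lemma A_min_two_in_C_min:
  "0 \<le> a \<Longrightarrow> a \<le> b \<Longrightarrow> A_min (vec_of_list [a, b]) \<in> C_min 2"
  unfolding C_min_def
  by (intro CollectI exI[of _ "vec_of_list [a, b]"])
    (auto simp: vec_two less_2_cases_iff simp del: vec_of_list_Cons intro!: mono_onI)

lemma A_max_two_in_C_max:
  "0 \<le> a \<Longrightarrow> a \<le> b \<Longrightarrow> A_max (vec_of_list [b, a]) \<in> C_max 2"
  unfolding C_max_def
  by (intro CollectI exI[of _ "vec_of_list [b, a]"])
    (auto simp: vec_two less_2_cases_iff monotone_on_def simp del: vec_of_list_Cons)

lemma map_mat_A_min_two:
  "map_mat f (A_min (vec_of_list [a, b])) = A_min (vec_of_list [f a, f b])"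
  unfolding A_min_def
  by (rule eq_matI) (auto simp: vec_two less_2_cases_iff numeral_2_eq_2 less_Suc_eq)

lemma map_mat_A_max_two:
  "map_mat f (A_max (vec_of_list [a, b])) = A_max (vec_of_list [f a, f b])"
  unfolding A_max_def
  by (rule eq_matI) (auto simp: vec_two less_2_cases_iff numeral_2_eq_2 less_Suc_eq)

lemma linear_if_automorphism_C_min_two:
  assumes "bij_betw f {0..} {0..}" "loewner_automorphism (C_min 2) (map_mat f)"
  shows "\<exists>c>0. \<forall>t\<ge>0. f t = c * t"
proof -
  interpret increment_comparison f
  proof
    fix a b c d :: real
    assume "0 \<le> a" "a \<le> b" "0 \<le> c" "c \<le> d"
    then show "a \<le> c \<and> b - a \<le> d - c \<longleftrightarrow> f a \<le> f c \<and> f b - f a \<le> f d - f c"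
      using assms(2) A_min_two_in_C_min unfolding loewner_automorphism_def
      by (metis loewner_le_A_min_two map_mat_A_min_two)
  qed (rule assms(1))
  show ?thesis by (rule linear)
qed

lemma linear_if_automorphism_C_max_two:
  assumes "bij_betw f {0..} {0..}" "loewner_automorphism (C_max 2) (map_mat f)"
  shows "\<exists>c>0. \<forall>t\<ge>0. f t = c * t"
proof -
  interpret increment_comparison f
  proof
    fix a b c d :: real
    assume "0 \<le> a" "a \<le> b" "0 \<le> c" "c \<le> d"
    then show "a \<le> c \<and> b - a \<le> d - c \<longleftrightarrow> f a \<le> f c \<and> f b - f a \<le> f d - f c"
      using assms(2) A_max_two_in_C_max unfolding loewner_automorphism_def
      by (metis loewner_le_A_max_two map_mat_A_max_two)
  qed (rule assms(1))
  show ?thesis by (rule linear)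
qed

section \<open>Positive scalars as automorphisms\<close>

lemma smult_smult_inverse:
  fixes A :: "real mat"
  shows "c \<noteq> 0 \<Longrightarrow> inverse c \<cdot>\<^sub>m (c \<cdot>\<^sub>m A) = A" "c \<noteq> 0 \<Longrightarrow> c \<cdot>\<^sub>m (inverse c \<cdot>\<^sub>m A) = A"
  by (auto intro!: eq_matI)

lemma loewner_le_smult:
  assumes "0 < c" "A \<preceq>\<^sub>L B"
  shows "c \<cdot>\<^sub>m A \<preceq>\<^sub>L c \<cdot>\<^sub>m B"
proof -
  have sym_smult: "symmetric_mat (c \<cdot>\<^sub>m M)" if "symmetric_mat M" for M
  proof -
    have "(c \<cdot>\<^sub>m M)\<^sup>T = c \<cdot>\<^sub>m M\<^sup>T" by (rule eq_matI) auto
    then show ?thesis using that unfolding symmetric_mat_def by simp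
  qed
  have sq: "dim_col A = dim_row A" "dim_col B = dim_row B" "dim_row A = dim_row B"
    using assms(2) unfolding loewner_le_def symmetric_mat_def
    by (metis index_transpose_mat(2), metis index_transpose_mat(2), blast)
  have diff: "c \<cdot>\<^sub>m B - c \<cdot>\<^sub>m A = c \<cdot>\<^sub>m (B - A)"
    using sq by (intro eq_matI) (auto simp: algebra_simps)
  have D: "B - A \<in> carrier_mat (dim_row A) (dim_row A)" using sq by auto
  have "pos_semidef (c \<cdot>\<^sub>m (B - A))"
    unfolding pos_semidef_def
  proof (intro conjI ballI)
    show "symmetric_mat (c \<cdot>\<^sub>m (B - A))"
      using assms(2) by (intro sym_smult) (simp add: loewner_le_def pos_semidef_def)
    fix v :: "real vec"
    assume "v \<in> carrier_vec (dim_row (c \<cdot>\<^sub>m (B - A)))"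
    then have v: "v \<in> carrier_vec (dim_row A)" by simp
    have "(c \<cdot>\<^sub>m (B - A)) *\<^sub>v v = c \<cdot>\<^sub>v ((B - A) *\<^sub>v v)"
      using D v by (intro eq_vecI) (auto simp: scalar_prod_def sum_distrib_left mult.assoc)
    then have "v \<bullet> ((c \<cdot>\<^sub>m (B - A)) *\<^sub>v v) = c * (v \<bullet> ((B - A) *\<^sub>v v))"
      using D v by (simp add: scalar_prod_smult_right)
    moreover have "0 \<le> v \<bullet> ((B - A) *\<^sub>v v)"
      using assms(2) v sq unfolding loewner_le_def pos_semidef_def by simp
    ultimately show "0 \<le> v \<bullet> ((c \<cdot>\<^sub>m (B - A)) *\<^sub>v v)" using assms(1) by simp
  qed
  then show ?thesis
    using assms(2) diff sym_smult unfolding loewner_le_def by simp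
qed

text \<open>Scaling by \<open>inverse c\<close> provides both the inverse map and its monotonicity.\<close>

lemma loewner_automorphism_scaling:
  assumes closed: "\<And>d A. 0 < d \<Longrightarrow> A \<in> C \<Longrightarrow> d \<cdot>\<^sub>m A \<in> C"
    and "0 < c" and \<Phi>: "\<And>A. A \<in> C \<Longrightarrow> \<Phi> A = c \<cdot>\<^sub>m A"
  shows "loewner_automorphism C \<Phi>"
proof -
  have "bij_betw (\<lambda>A. c \<cdot>\<^sub>m A) C C"
    by (rule bij_betwI[where g = "\<lambda>A. inverse c \<cdot>\<^sub>m A"])
      (use \<open>0 < c\<close> closed smult_smult_inverse in auto)
  then have "bij_betw \<Phi> C C" using \<Phi> by (subst bij_betw_cong) auto
  moreover have "A \<preceq>\<^sub>L B \<longleftrightarrow> c \<cdot>\<^sub>m A \<preceq>\<^sub>L c \<cdot>\<^sub>m B" for A B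
    using loewner_le_smult[of c A B] loewner_le_smult[of "inverse c" "c \<cdot>\<^sub>m A" "c \<cdot>\<^sub>m B"]
      \<open>0 < c\<close> smult_smult_inverse(1)[of c] by auto
  ultimately show ?thesis unfolding loewner_automorphism_def using \<Phi> by simp
qed

lemma C_min_smult:
  assumes "0 < d" "A \<in> C_min n"
  shows "d \<cdot>\<^sub>m A \<in> C_min n"
proof -
  obtain x where x: "A = A_min x" "x \<in> carrier_vec n" "\<forall>i<n. 0 \<le> x $ i"
    "mono_on {..<n} (\<lambda>i. x $ i)"
    using assms(2) unfolding C_min_def by blast
  have "d \<cdot>\<^sub>m A = A_min (d \<cdot>\<^sub>v x)"
    unfolding x(1) A_min_def by (rule eq_matI) auto
  then show ?thesis
    unfolding C_min_def using x assms(1)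
    by (intro CollectI exI[of _ "d \<cdot>\<^sub>v x"]) (auto simp: monotone_on_def)
qed

lemma C_max_smult:
  assumes "0 < d" "A \<in> C_max n"
  shows "d \<cdot>\<^sub>m A \<in> C_max n"
proof -
  obtain x where x: "A = A_max x" "x \<in> carrier_vec n" "\<forall>i<n. 0 \<le> x $ i"
    "antimono_on {..<n} (\<lambda>i. x $ i)"
    using assms(2) unfolding C_max_def by blast
  have "d \<cdot>\<^sub>m A = A_max (d \<cdot>\<^sub>v x)"
    unfolding x(1) A_max_def by (rule eq_matI) auto
  then show ?thesis
    unfolding C_max_def using x assms(1)
    by (intro CollectI exI[of _ "d \<cdot>\<^sub>v x"]) (auto simp: monotone_on_def)
qed

lemma map_mat_eq_smult_C_min:
  assumes "\<forall>t\<ge>0. f t = c * t" "A \<in> C_min n"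
  shows "map_mat f A = c \<cdot>\<^sub>m A"
  using assms unfolding C_min_def by (auto simp: A_min_def min_def intro!: eq_matI)

lemma map_mat_eq_smult_C_max:
  assumes "\<forall>t\<ge>0. f t = c * t" "A \<in> C_max n"
  shows "map_mat f A = c \<cdot>\<^sub>m A"
  using assms unfolding C_max_def by (auto simp: A_max_def max_def intro!: eq_matI)

section \<open>Entrywise automorphisms of the two families of cones\<close>

theorem corollary5p9:
  fixes f :: "real \<Rightarrow> real"
  assumes "bij_betw f {0..} {0..}"
  shows "((\<forall>n\<ge>1. loewner_automorphism (C_min n) (map_mat f)) \<longleftrightarrow> (\<exists>c>0. \<forall>t\<ge>0. f t = c * t))
       \<and> ((\<forall>n\<ge>1. loewner_automorphism (C_max n) (map_mat f)) \<longleftrightarrow> (\<exists>c>0. \<forall>t\<ge>0. f t = c * t))"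
proof -
  have "loewner_automorphism (C_min n) (map_mat f) \<and> loewner_automorphism (C_max n) (map_mat f)"
    if linear: "\<exists>c>0. \<forall>t\<ge>0. f t = c * t" for n
  proof -
    obtain c where "0 < c" and f: "\<forall>t\<ge>0. f t = c * t" using linear by blast
    show ?thesis
      using \<open>0 < c\<close> f
      by (intro conjI loewner_automorphism_scaling[where c = c])
        (auto intro: C_min_smult C_max_smult map_mat_eq_smult_C_min map_mat_eq_smult_C_max)
  qed
  moreover have "(1 :: nat) \<le> 2" by simp
  ultimately show ?thesis
    using linear_if_automorphism_C_min_two[OF assms] linear_if_automorphism_C_max_two[OF assms]
    by blast
qed

end
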